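(* There is a constant $C$ such that for every $n$, $s(n, \chi_{>3}) \leq \frac{21}{64} n^2 + Cn$, both when Mini moves first and when Max moves first.
   Context: Let $\mathcal{P}$ be a monotone increasing property of graphs on vertex set $[n]$. An edge $e \in \binom{[n]}{2}\setminus E(G)$ is legal with respect to a graph $G \notin \mathcal{P}$ if $G \cup \{e\} \notin \mathcal{P}$. The saturation game $(n,\mathcal{P})$: starting from the empty graph on $[n]$, two players, Mini and Max, alternately add a legal edge to the current graph $G$. The game ends when no legal edge exists. Max wants to maximize the number of edges of the final graph and Mini wants to minimize it. The score $s(n,\mathcal{P})$ is the number of edges of the final graph under optimal play by both players; it may depend on which player moves first. $\chi_{>k}$ denotes the property of having chromatic number at least $k+1$. *)

theory Defs
  imports Complex_Main
begin

text \<open>A graph on the vertex set \<open>[n] = {1..n}\<close> is given by its edge set, a subset of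
  \<open>all_edges n\<close>; a graph property for this vertex set is a predicate on edge sets.\<close>

definition all_edges :: "nat \<Rightarrow> nat set set" where
  "all_edges n = {e. e \<subseteq> {1..n} \<and> card e = 2}"

lemma finite_all_edges: "finite (all_edges n)"
  by (rule finite_subset[of _ "Pow {1..n}"]) (auto simp: all_edges_def)

definition monotone_increasing :: "nat \<Rightarrow> (nat set set \<Rightarrow> bool) \<Rightarrow> bool" where
  "monotone_increasing n P \<longleftrightarrow>
     (\<forall>G H. G \<subseteq> H \<and> H \<subseteq> all_edges n \<and> P G \<longrightarrow> P H)"

definition proper_colouring :: "nat \<Rightarrow> nat set set \<Rightarrow> nat \<Rightarrow> (nat \<Rightarrow> nat) \<Rightarrow> bool" where
  "proper_colouring n G k f \<longleftrightarrow>
     f ` {1..n} \<subseteq> {..<k} \<and> (\<forall>u v. {u, v} \<in> G \<longrightarrow> f u \<noteq> f v)"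

definition chromatic_number :: "nat \<Rightarrow> nat set set \<Rightarrow> nat" where
  "chromatic_number n G = (LEAST k. \<exists>f. proper_colouring n G k f)"

definition chi_gt :: "nat \<Rightarrow> nat \<Rightarrow> nat set set \<Rightarrow> bool" where
  "chi_gt k n G \<longleftrightarrow> chromatic_number n G \<ge> k + 1"

lemma monotone_increasing_chi_gt: "monotone_increasing n (chi_gt k n)"
  unfolding monotone_increasing_def
proof (intro allI impI, elim conjE)
  fix G H assume GH: "G \<subseteq> H" and H: "H \<subseteq> all_edges n" and G: "chi_gt k n G"
  have "proper_colouring n H (Suc n) id"
    unfolding proper_colouring_def
  proof (intro conjI allI impI)
    show "id ` {1..n} \<subseteq> {..<Suc n}" by auto
    fix u v assume "{u, v} \<in> H"
    with H have "{u, v} \<in> all_edges n" by (rule subsetD)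
    then have "card {u, v} = 2" unfolding all_edges_def by (rule CollectE) (rule conjunct2)
    then show "id u \<noteq> id v" by (cases "u = v") simp_all
  qed
  then have "\<exists>f. proper_colouring n H (Suc n) f" by (rule exI[of _ id])
  then have "\<exists>f. proper_colouring n H (chromatic_number n H) f"
    unfolding chromatic_number_def by (rule LeastI)
  then obtain f where f: "proper_colouring n H (chromatic_number n H) f" ..
  have "proper_colouring n G (chromatic_number n H) f"
    using f GH by (simp add: proper_colouring_def subset_iff)
  then have "\<exists>f. proper_colouring n G (chromatic_number n H) f" by (rule exI[of _ f])
  then have "chromatic_number n G \<le> chromatic_number n H"
    unfolding chromatic_number_def[of n G] by (rule Least_le)
  with G show "chi_gt k n H" by (simp add: chi_gt_def)
qed

definition legal_edges :: "nat \<Rightarrow> (nat set set \<Rightarrow> bool) \<Rightarrow> nat set set \<Rightarrow> nat set set" where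
  "legal_edges n P G = {e \<in> all_edges n - G. \<not> P (insert e G)}"

text \<open>The maximizing player is called \<open>Maxi\<close> because the constant \<^const>\<open>Max\<close> is the maximum of a
  finite set.\<close>

datatype player = Mini | Maxi

text \<open>\<open>game_value n P p G\<close> is the number of edges of the final graph under optimal play when
  the current graph is \<open>G\<close> and it is the turn of \<open>p\<close>, computed by backward induction.\<close>

function game_value :: "nat \<Rightarrow> (nat set set \<Rightarrow> bool) \<Rightarrow> player \<Rightarrow> nat set set \<Rightarrow> nat" where
  "game_value n P p G =
     (if legal_edges n P G = {} then card G
      else case p of
        Mini \<Rightarrow> Min ((\<lambda>e. game_value n P Maxi (insert e G)) ` legal_edges n P G)
      | Maxi \<Rightarrow> Max ((\<lambda>e. game_value n P Mini (insert e G)) ` legal_edges n P G))"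
  by pat_completeness auto
termination
proof (relation "measure (\<lambda>(n, P, p, G). card (all_edges n - G))")
  have *: "card (all_edges n - insert e G) < card (all_edges n - G)"
    if "e \<in> legal_edges n P G" for n P G e
    using that by (intro psubset_card_mono) (auto simp: legal_edges_def finite_all_edges)
  show "((n, P, Maxi, insert e G), (n, P, p, G)) \<in> measure (\<lambda>(n, P, p, G). card (all_edges n - G))"
    if "e \<in> legal_edges n P G" for n P p G e
    using *[OF that] by simp
  show "((n, P, Mini, insert e G), (n, P, p, G)) \<in> measure (\<lambda>(n, P, p, G). card (all_edges n - G))"
    if "e \<in> legal_edges n P G" for n P p G e
    using *[OF that] by simp
qed simp

declare game_value.simps [simp del]

definition score :: "nat \<Rightarrow> (nat set set \<Rightarrow> bool) \<Rightarrow> player \<Rightarrow> nat" where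
  "score n P first = game_value n P first {}"

end

theory Submission
  imports Defs "HOL-Analysis.Convex"
begin

text \<open>Mini fixes a vertex \<open>v\<close> and plays her edges at \<open>v\<close>, so as to leave it with at most
  \<open>n / 4\<close> non-neighbours; the colour class of \<open>v\<close> in the final 3-partite graph then has at most
  \<open>n / 4 + 1\<close> vertices, and the best Max can hope for is parts of relative sizes
  \<open>1/4, 3/8, 3/8\<close>, which gives \<open>21/64 n\<^sup>2\<close> edges.
  A non-neighbour of \<open>v\<close> of degree at most one can always be joined to \<open>v\<close>, so only those
  of degree at least two may be lost. Give non-neighbours of \<open>v\<close> the weight
  \<open>1\<close>, \<open>2\<close> or \<open>4\<close> according to whether their degree is \<open>0\<close>, \<open>1\<close> or larger. Mini can answer
  every move of Max so that the total weight, increased by \<open>1\<close> if some vertex is exposed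
  in the sense below, stays below \<open>n\<close>; once only vertices of weight \<open>4\<close> are left, there are
  at most \<open>n / 4\<close> of them.\<close>

subsection \<open>Neighbours and degrees\<close>

definition neighbours :: "nat set set \<Rightarrow> nat \<Rightarrow> nat set" where
  "neighbours G u = {w. {u, w} \<in> G}"

definition degree :: "nat set set \<Rightarrow> nat \<Rightarrow> nat" where
  "degree G u = card (neighbours G u)"

definition delete_vertex :: "nat set set \<Rightarrow> nat \<Rightarrow> nat set set" where
  "delete_vertex G u = {e \<in> G. u \<notin> e}"

lemma doubleton_in_all_edges_iff:
  "{a, b} \<in> all_edges n \<longleftrightarrow> a \<noteq> b \<and> a \<in> {1..n} \<and> b \<in> {1..n}"
  by (auto simp: all_edges_def card_2_iff doubleton_eq_iff)

lemma edgeD: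
  assumes "G \<subseteq> all_edges n" "{u, w} \<in> G"
  shows "u \<noteq> w" "u \<in> {1..n}" "w \<in> {1..n}"
  using assms doubleton_in_all_edges_iff by blast+

lemma all_edgesE:
  assumes "e \<in> all_edges n"
  obtains a b where "e = {a, b}" "a \<noteq> b" "a \<in> {1..n}" "b \<in> {1..n}"
  using assms by (auto simp: all_edges_def card_2_iff)

lemma neighbours_sym: "w \<in> neighbours G u \<longleftrightarrow> u \<in> neighbours G w"
  by (simp add: neighbours_def insert_commute)

lemma neighbours_subset:
  assumes "G \<subseteq> all_edges n"
  shows "neighbours G u \<subseteq> {1..n} - {u}"
  using edgeD[OF assms] by (auto simp: neighbours_def)

lemma finite_neighbours: "G \<subseteq> all_edges n \<Longrightarrow> finite (neighbours G u)"
  by (rule finite_subset[OF neighbours_subset]) auto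

lemma neighbours_empty [simp]: "neighbours {} u = {}"
  by (simp add: neighbours_def)

lemma neighbours_insert:
  "neighbours (insert {a, b} G) w =
     (if w = a then insert b (neighbours G a)
      else if w = b then insert a (neighbours G b)
      else neighbours G w)"
  by (rule set_eqI) (simp add: neighbours_def doubleton_eq_iff)

lemma neighbours_delete_vertex:
  "w \<noteq> u \<Longrightarrow> neighbours (delete_vertex G u) w = neighbours G w - {u}"
  by (auto simp: neighbours_def delete_vertex_def)

lemma degree_insert:
  assumes "G \<subseteq> all_edges n" "a \<noteq> b" "{a, b} \<notin> G"
  shows "degree (insert {a, b} G) w = degree G w + of_bool (w \<in> {a, b})"
proof -
  have "b \<notin> neighbours G a" "a \<notin> neighbours G b"
    using assms(3) by (simp_all add: neighbours_def insert_commute)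
  then show ?thesis
    using assms finite_neighbours[OF assms(1)] by (auto simp: degree_def neighbours_insert)
qed

lemma degree_delete_vertex:
  assumes "G \<subseteq> all_edges n" "{w, u} \<in> G"
  shows "degree (delete_vertex G u) w + 1 = degree G w"
proof -
  have "u \<in> neighbours G w" "w \<noteq> u"
    using assms edgeD(1) by (auto simp: neighbours_def)
  then show ?thesis
    using card_Suc_Diff1[OF finite_neighbours[OF assms(1)]]
    by (simp add: degree_def neighbours_delete_vertex)
qed

lemma degree_eq_1_iff: "degree G u = 1 \<longleftrightarrow> (\<exists>x. neighbours G u = {x})"
  by (simp add: degree_def card_1_singleton_iff)

lemma degree_eq_card_incident_edges:
  assumes "G \<subseteq> all_edges n"
  shows "degree G u = card {e \<in> G. u \<in> e}"
proof -
  have "bij_betw (\<lambda>w. {u, w}) (neighbours G u) {e \<in> G. u \<in> e}"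
  proof (rule bij_betw_imageI)
    show "inj_on (\<lambda>w. {u, w}) (neighbours G u)"
      by (auto simp: inj_on_def doubleton_eq_iff)
    have "\<exists>w. e = {u, w}" if "e \<in> G" "u \<in> e" for e
      using all_edgesE[of e n] assms that by (metis insertE insert_commute singletonD subsetD)
    then show "(\<lambda>w. {u, w}) ` neighbours G u = {e \<in> G. u \<in> e}"
      by (auto simp: neighbours_def)
  qed
  then show ?thesis
    by (simp add: degree_def bij_betw_same_card)
qed

lemma sum_degree:
  assumes "G \<subseteq> all_edges n"
  shows "(\<Sum>u\<in>{1..n}. degree G u) = 2 * card G"
proof -
  have "card {u \<in> {1..n}. u \<in> e} = 2" if "e \<in> G" for e
  proof -
    have "e \<subseteq> {1..n}" "card e = 2"
      using assms that by (auto simp: all_edges_def)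
    moreover from this have "{u \<in> {1..n}. u \<in> e} = e"
      by blast
    ultimately show ?thesis
      by simp
  qed
  then have "(\<Sum>u\<in>{1..n}. card {e \<in> G. u \<in> e}) = 2 * card G"
    using finite_subset[OF assms finite_all_edges] by (intro sum_multicount) auto
  then show ?thesis
    by (simp add: degree_eq_card_incident_edges[OF assms])
qed

subsection \<open>Colourability\<close>

definition colourable :: "nat \<Rightarrow> nat set set \<Rightarrow> nat \<Rightarrow> bool" where
  "colourable n G k \<longleftrightarrow> (\<exists>f. proper_colouring n G k f)"

lemma proper_colouring_less: "proper_colouring n G k f \<Longrightarrow> u \<in> {1..n} \<Longrightarrow> f u < k"
  unfolding proper_colouring_def by blast

lemma proper_colouring_neighbours:
  "proper_colouring n G k f \<Longrightarrow> w \<in> neighbours G u \<Longrightarrow> f u \<noteq> f w"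
  by (simp add: proper_colouring_def neighbours_def)

lemma colourable_mono_edges: "colourable n H k \<Longrightarrow> G \<subseteq> H \<Longrightarrow> colourable n G k"
  unfolding colourable_def proper_colouring_def by (meson subsetD)

lemma colourable_mono_colours: "colourable n G k \<Longrightarrow> k \<le> l \<Longrightarrow> colourable n G l"
  unfolding colourable_def proper_colouring_def by (meson lessThan_subset_iff subset_trans)

lemma colourable_empty: "k > 0 \<Longrightarrow> colourable n {} k"
  by (auto simp: colourable_def proper_colouring_def)

lemma colourable_Suc_n:
  assumes "G \<subseteq> all_edges n"
  shows "colourable n G (Suc n)"
proof -
  have "proper_colouring n G (Suc n) id"
    using edgeD(1)[OF assms] by (auto simp: proper_colouring_def)
  then show ?thesis
    by (auto simp: colourable_def)
qed

lemma chromatic_number_le_iff: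
  assumes "G \<subseteq> all_edges n"
  shows "chromatic_number n G \<le> k \<longleftrightarrow> colourable n G k"
proof
  have "colourable n G (chromatic_number n G)"
    unfolding chromatic_number_def colourable_def[symmetric]
    using colourable_Suc_n[OF assms] by (rule LeastI)
  then show "chromatic_number n G \<le> k \<Longrightarrow> colourable n G k"
    by (rule colourable_mono_colours)
  show "colourable n G k \<Longrightarrow> chromatic_number n G \<le> k"
    unfolding chromatic_number_def colourable_def by (rule Least_le)
qed

lemma legal_edges_chi_gt:
  assumes "G \<subseteq> all_edges n"
  shows "legal_edges n (chi_gt k n) G = {e \<in> all_edges n - G. colourable n (insert e G) k}"
proof -
  have "\<not> chi_gt k n (insert e G) \<longleftrightarrow> colourable n (insert e G) k" if "e \<in> all_edges n" for e
    using chromatic_number_le_iff[of "insert e G" n k] assms that by (auto simp: chi_gt_def)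
  then show ?thesis
    by (auto simp: legal_edges_def)
qed

lemma colourable_delete_vertexD:
  assumes "colourable n (delete_vertex G u) k" "G \<subseteq> all_edges n" "degree G u < k"
  shows "colourable n G k"
proof -
  obtain f where f: "proper_colouring n (delete_vertex G u) k f"
    using assms(1) by (auto simp: colourable_def)
  have fin: "finite (neighbours G u)"
    using assms(2) by (rule finite_neighbours)
  have "card (f ` neighbours G u) < card {..<k}"
    using card_image_le[OF fin, of f] assms(3) by (simp add: degree_def)
  then have "\<not> {..<k} \<subseteq> f ` neighbours G u"
    using card_mono[of "f ` neighbours G u" "{..<k}"] fin by auto
  then obtain c where c: "c < k" "c \<notin> f ` neighbours G u"
    by auto
  have "(f(u := c)) a \<noteq> (f(u := c)) b" if "{a, b} \<in> G" for a b
  proof -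
    have "b \<in> neighbours G a" "a \<in> neighbours G b" "a \<noteq> b"
      using that edgeD(1)[OF assms(2)] by (auto simp: neighbours_def insert_commute)
    moreover have "f a \<noteq> f b" if "u \<notin> {a, b}"
      using f \<open>{a, b} \<in> G\<close> that by (auto simp: proper_colouring_def delete_vertex_def)
    ultimately show ?thesis
      using c(2) by auto
  qed
  then have "proper_colouring n G k (f(u := c))"
    using f c(1) by (auto simp: proper_colouring_def)
  then show ?thesis
    by (auto simp: colourable_def)
qed

lemma colourable_insert_low_degree:
  assumes "colourable n G k" "insert {v, u} G \<subseteq> all_edges n" "degree G u + 1 < k"
  shows "colourable n (insert {v, u} G) k"
proof (cases "{v, u} \<in> G")
  case True
  then show ?thesis
    using assms(1) by (simp add: insert_absorb)
next
  case False
  show ?thesis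
  proof (rule colourable_delete_vertexD[OF _ assms(2)])
    show "colourable n (delete_vertex (insert {v, u} G) u) k"
      using assms(1) by (rule colourable_mono_edges) (auto simp: delete_vertex_def)
    have "v \<noteq> u"
      using assms(2) by (simp add: doubleton_in_all_edges_iff)
    then show "degree (insert {v, u} G) u < k"
      using assms(2,3) False by (simp add: degree_insert[of G n])
  qed
qed

lemma colourable_insert_adjacent_low_degrees:
  assumes "colourable n G k" "insert {v, a} G \<subseteq> all_edges n" "{a, b} \<in> G" "b \<noteq> v"
    and "degree G a < k" "degree G b < k"
  shows "colourable n (insert {v, a} G) k"
proof (rule colourable_delete_vertexD[OF _ assms(2)])
  have "a \<noteq> b"
    using assms(2,3) edgeD(1) by blast
  then show "degree (insert {v, a} G) b < k"
    using assms(4,6) by (simp add: degree_def neighbours_insert)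
  have delete: "delete_vertex (insert {v, a} G) b = insert {v, a} (delete_vertex G b)"
    using \<open>a \<noteq> b\<close> assms(4) by (auto simp: delete_vertex_def)
  show "colourable n (delete_vertex (insert {v, a} G) b) k"
    unfolding delete
  proof (rule colourable_insert_low_degree)
    show "colourable n (delete_vertex G b) k"
      using assms(1) by (rule colourable_mono_edges) (auto simp: delete_vertex_def)
    show "insert {v, a} (delete_vertex G b) \<subseteq> all_edges n"
      using assms(2) by (auto simp: delete_vertex_def)
    show "degree (delete_vertex G b) a + 1 < k"
      using degree_delete_vertex[of G n a b] assms(2,3,5) by simp
  qed
qed

subsection \<open>Counting edges by colour classes\<close>

definition colour_class :: "nat \<Rightarrow> (nat \<Rightarrow> nat) \<Rightarrow> nat \<Rightarrow> nat set" where
  "colour_class n f i = {u \<in> {1..n}. f u = i}"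

lemma sum_over_colour_classes:
  fixes g :: "nat \<Rightarrow> nat"
  assumes "proper_colouring n G k f"
  shows "(\<Sum>u\<in>{1..n}. g (f u)) = (\<Sum>i<k. card (colour_class n f i) * g i)"
  using sum_fun_comp[of "{1..n}" "{..<k}" f g] assms
  by (simp add: proper_colouring_def colour_class_def)

lemma card_edges_colour_classes:
  assumes "G \<subseteq> all_edges n" "proper_colouring n G k f"
  shows "2 * card G + (\<Sum>i<k. (card (colour_class n f i))\<^sup>2) \<le> n\<^sup>2"
proof -
  have "degree G u + card (colour_class n f (f u)) \<le> n" for u
  proof -
    have "neighbours G u \<inter> colour_class n f (f u) = {}"
      using proper_colouring_neighbours[OF assms(2), of _ u] by (fastforce simp: colour_class_def)
    moreover have "neighbours G u \<union> colour_class n f (f u) \<subseteq> {1..n}"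
      using neighbours_subset[OF assms(1)] by (auto simp: colour_class_def)
    ultimately show ?thesis
      using card_Un_disjoint[of "neighbours G u" "colour_class n f (f u)"]
        card_mono[of "{1..n}" "neighbours G u \<union> colour_class n f (f u)"]
      by (simp add: degree_def finite_neighbours[OF assms(1)] colour_class_def)
  qed
  then have "(\<Sum>u\<in>{1..n}. degree G u + card (colour_class n f (f u))) \<le> (\<Sum>u\<in>{1..n}. n)"
    by (rule sum_mono)
  then show ?thesis
    using sum_over_colour_classes[OF assms(2), of "\<lambda>i. card (colour_class n f i)"]
    by (simp add: sum.distrib sum_degree[OF assms(1)] power2_eq_square del: One_nat_def)
qed

lemma card_edges_colour_class:
  assumes "G \<subseteq> all_edges n" "proper_colouring n G (Suc k) f" "i < Suc k"
  defines "x \<equiv> real (card (colour_class n f i))"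
  shows "real k * (2 * real (card G) + x\<^sup>2) + (real n - x)\<^sup>2 \<le> real k * (real n)\<^sup>2"
proof -
  define s where "s j = real (card (colour_class n f j))" for j
  have "real n = real (\<Sum>j<Suc k. card (colour_class n f j))"
    using sum_over_colour_classes[OF assms(2), of "\<lambda>_. 1"] by simp
  also have "\<dots> = x + (\<Sum>j\<in>{..<Suc k} - {i}. s j)"
    using assms(3) by (simp add: x_def s_def sum.remove[of _ i] del: sum.lessThan_Suc)
  finally have "(real n - x)\<^sup>2 \<le> (\<Sum>j\<in>{..<Suc k} - {i}. (s j)\<^sup>2) * real k"
    using sum_squared_le_sum_of_squares[of s "{..<Suc k} - {i}"] assms(3) by simp
  moreover have "2 * real (card G) + (\<Sum>j<Suc k. (s j)\<^sup>2) \<le> (real n)\<^sup>2"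
    using of_nat_mono[OF card_edges_colour_classes[OF assms(1,2)], where 'a = real]
    by (simp add: s_def del: sum.lessThan_Suc)
  then have "2 * real (card G) + x\<^sup>2 + (\<Sum>j\<in>{..<Suc k} - {i}. (s j)\<^sup>2) \<le> (real n)\<^sup>2"
    using assms(3) by (simp add: x_def s_def sum.remove[of _ i] del: sum.lessThan_Suc)
  then have "real k * (2 * real (card G) + x\<^sup>2 + (\<Sum>j\<in>{..<Suc k} - {i}. (s j)\<^sup>2))
      \<le> real k * (real n)\<^sup>2"
    by (intro mult_left_mono) auto
  ultimately show ?thesis
    by (simp add: algebra_simps)
qed

subsection \<open>Bounding the value of a game\<close>

lemma finite_legal_edges: "finite (legal_edges n P G)"
  using finite_all_edges[of n] by (simp add: legal_edges_def)

lemma game_value_final: "legal_edges n P G = {} \<Longrightarrow> game_value n P p G = card G"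
  by (simp add: game_value.simps)

lemma game_value_Mini_le:
  assumes "e \<in> legal_edges n P G"
  shows "game_value n P Mini G \<le> game_value n P Maxi (insert e G)"
  using assms finite_legal_edges
  by (subst game_value.simps) (auto intro: Min_le)

lemma game_value_MaxiE:
  assumes "legal_edges n P G \<noteq> {}"
  obtains e where "e \<in> legal_edges n P G"
    "game_value n P Maxi G = game_value n P Mini (insert e G)"
proof -
  let ?values = "(\<lambda>e. game_value n P Mini (insert e G)) ` legal_edges n P G"
  have "Max ?values \<in> ?values"
    using assms finite_legal_edges by (intro Max_in) auto
  moreover have "game_value n P Maxi G = Max ?values"
    using assms by (subst game_value.simps) simp
  ultimately have "game_value n P Maxi G \<in> ?values"
    by simp
  then show thesis
    using that by (elim imageE)
qed

lemma game_value_le: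
  assumes "Inv p G"
    and "\<And>p G. Inv p G \<Longrightarrow> legal_edges n P G = {} \<Longrightarrow> real (card G) \<le> T"
    and "\<And>G e. Inv Maxi G \<Longrightarrow> e \<in> legal_edges n P G \<Longrightarrow> Inv Mini (insert e G)"
    and "\<And>G. Inv Mini G \<Longrightarrow> legal_edges n P G \<noteq> {} \<Longrightarrow>
      \<exists>e\<in>legal_edges n P G. Inv Maxi (insert e G)"
  shows "real (game_value n P p G) \<le> T"
  using assms
proof (induction n P p G rule: game_value.induct)
  case (1 n P p G)
  note IH_Mini = "1.IH"(1) and IH_Maxi = "1.IH"(2)
    and inv = "1.prems"(1) and strategy = "1.prems"(2-4)
  consider (final) "legal_edges n P G = {}" | (Mini) "legal_edges n P G \<noteq> {}" "p = Mini"
    | (Maxi) "legal_edges n P G \<noteq> {}" "p = Maxi"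
    using player.exhaust by blast
  then show ?case
  proof cases
    case final
    then show ?thesis
      using inv strategy(1) by (simp add: game_value_final)
  next
    case Mini
    then obtain e where e: "e \<in> legal_edges n P G" "Inv Maxi (insert e G)"
      using inv strategy(3) by blast
    have "real (game_value n P Maxi (insert e G)) \<le> T"
      using e(2) strategy by (rule IH_Mini[OF Mini e(1)])
    then show ?thesis
      using game_value_Mini_le[OF e(1)] Mini(2) by simp
  next
    case Maxi
    obtain e where e: "e \<in> legal_edges n P G"
      "game_value n P Maxi G = game_value n P Mini (insert e G)"
      using Maxi(1) by (rule game_value_MaxiE)
    have "Inv Mini (insert e G)"
      using inv strategy(2) Maxi(2) e(1) by blast
    then have "real (game_value n P Mini (insert e G)) \<le> T"
      using strategy by (rule IH_Maxi[OF Maxi e(1)])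
    then show ?thesis
      using e(2) Maxi(2) by simp
  qed
qed

subsection \<open>The potential of a position\<close>

definition non_neighbours :: "nat \<Rightarrow> nat set set \<Rightarrow> nat \<Rightarrow> nat set" where
  "non_neighbours n G v = {1..n} - {v} - neighbours G v"

definition light :: "nat \<Rightarrow> nat set set \<Rightarrow> nat \<Rightarrow> nat set" where
  "light n G v = {u \<in> non_neighbours n G v. degree G u \<le> 1}"

definition weight :: "nat set set \<Rightarrow> nat \<Rightarrow> nat" where
  "weight G u = 2 ^ min 2 (degree G u)"

definition total_weight :: "nat \<Rightarrow> nat set set \<Rightarrow> nat \<Rightarrow> nat" where
  "total_weight n G v = (\<Sum>u\<in>non_neighbours n G v. weight G u)"

text \<open>If a non-neighbour \<open>u\<close> of degree \<open>1\<close> is not exposed, then Max cannot prevent Mini from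
  joining it to \<open>v\<close> by adding one edge at \<open>u\<close>: then \<open>u\<close> and its old neighbour \<open>x\<close> both have
  degree \<open>2\<close>, so both can be recoloured.\<close>

definition exposed :: "nat \<Rightarrow> nat set set \<Rightarrow> nat \<Rightarrow> nat set" where
  "exposed n G v =
     {u \<in> non_neighbours n G v. \<exists>x. neighbours G u = {x} \<and> neighbours G x \<noteq> {v, u}}"

definition potential :: "nat \<Rightarrow> nat set set \<Rightarrow> nat \<Rightarrow> nat" where
  "potential n G v = total_weight n G v + of_bool (exposed n G v \<noteq> {})"

lemma finite_non_neighbours: "finite (non_neighbours n G v)"
  by (simp add: non_neighbours_def)

lemma non_neighbours_sym: "u \<in> non_neighbours n G v \<Longrightarrow> v \<notin> neighbours G u"
  by (simp add: non_neighbours_def neighbours_sym)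

lemma non_neighbours_antimono: "G \<subseteq> H \<Longrightarrow> non_neighbours n H v \<subseteq> non_neighbours n G v"
  by (auto simp: non_neighbours_def neighbours_def)

lemma card_non_neighbours_antimono:
  "G \<subseteq> H \<Longrightarrow> card (non_neighbours n H v) \<le> card (non_neighbours n G v)"
  by (intro card_mono finite_non_neighbours non_neighbours_antimono)

lemma non_neighbours_insert:
  "v \<notin> {a, b} \<Longrightarrow> non_neighbours n (insert {a, b} G) v = non_neighbours n G v"
  by (auto simp: non_neighbours_def neighbours_insert)

lemma non_neighbours_join:
  "non_neighbours n (insert {v, u} G) v = non_neighbours n G v - {u}"
  by (auto simp: non_neighbours_def neighbours_insert)

lemma total_weight_empty: "v \<in> {1..n} \<Longrightarrow> total_weight n {} v = n - 1"
  by (simp add: total_weight_def non_neighbours_def weight_def degree_def)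

lemma total_weight_insert:
  assumes "G \<subseteq> all_edges n" "a \<noteq> b" "{a, b} \<notin> G" "v \<notin> {a, b}"
  shows "total_weight n (insert {a, b} G) v =
    total_weight n G v + (\<Sum>u\<in>{a, b} \<inter> light n G v. weight G u)"
proof -
  let ?N = "non_neighbours n G v"
  have "weight (insert {a, b} G) u =
      weight G u + (if u \<in> {a, b} \<inter> light n G v then weight G u else 0)" if "u \<in> ?N" for u
    using that by (auto simp: weight_def light_def degree_insert[OF assms(1-3)] min_def le_Suc_eq)
  then have "total_weight n (insert {a, b} G) v =
      total_weight n G v + (\<Sum>u\<in>?N. if u \<in> {a, b} \<inter> light n G v then weight G u else 0)"
    using assms(4) by (simp add: total_weight_def non_neighbours_insert flip: sum.distrib)
  moreover have "?N \<inter> ({a, b} \<inter> light n G v) = {a, b} \<inter> light n G v"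
    by (auto simp: light_def)
  ultimately show ?thesis
    by (simp only: sum.inter_restrict[OF finite_non_neighbours, symmetric])
qed

lemma total_weight_join:
  assumes "u \<in> non_neighbours n G v"
  shows "total_weight n (insert {v, u} G) v + weight G u = total_weight n G v"
proof -
  have "weight (insert {v, u} G) w = weight G w" if "w \<in> non_neighbours n G v - {u}" for w
    using that by (auto simp: weight_def degree_def neighbours_insert non_neighbours_def)
  then show ?thesis
    using sum.remove[OF finite_non_neighbours assms, of "weight G"]
    by (simp add: total_weight_def non_neighbours_join)
qed

lemma total_weight_insert_join:
  assumes "G \<subseteq> all_edges n" "a \<noteq> b" "{a, b} \<notin> G" "b \<noteq> v" "a \<in> light n G v"
  shows "total_weight n (insert {v, a} (insert {a, b} G)) v + weight G a =
    total_weight n G v + (if b \<in> light n G v then weight G b else 0)"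
proof -
  have a: "a \<in> non_neighbours n (insert {a, b} G) v" and "v \<notin> {a, b}"
    using assms(4,5) by (auto simp: light_def non_neighbours_def neighbours_insert)
  have "weight (insert {a, b} G) a = 2 * weight G a"
    using assms(5) by (auto simp: weight_def light_def degree_insert[OF assms(1-3)] le_Suc_eq)
  then show ?thesis
    using total_weight_join[OF a] total_weight_insert[OF assms(1-3) \<open>v \<notin> {a, b}\<close>] assms(2,5)
    by (cases "b \<in> light n G v") simp_all
qed

lemma total_weight_insert_le:
  assumes "G \<subseteq> all_edges n" "e \<in> all_edges n - G" "v \<in> e \<or> e \<inter> light n G v = {}"
  shows "total_weight n (insert e G) v \<le> total_weight n G v"
proof -
  obtain a b where ab: "e = {a, b}" "a \<noteq> b" "a \<in> {1..n}" "b \<in> {1..n}"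
    using assms(2) by (auto elim: all_edgesE)
  show ?thesis
  proof (cases "v \<in> e")
    case True
    then obtain u where u: "e = {v, u}" "u \<in> {1..n} - {v}"
      using ab by auto
    then have "u \<in> non_neighbours n G v"
      using assms(2) by (simp add: non_neighbours_def neighbours_def)
    then show ?thesis
      using total_weight_join[of u n G v] u(1) by simp
  next
    case False
    then show ?thesis
      using total_weight_insert[of G n a b v] assms ab(1,2) by simp
  qed
qed

lemma total_weight_no_light:
  assumes "light n G v = {}"
  shows "total_weight n G v = 4 * card (non_neighbours n G v)"
proof -
  have "weight G u = 4" if "u \<in> non_neighbours n G v" for u
  proof -
    have "degree G u \<ge> 2"
      using that assms by (auto simp: light_def)
    then show ?thesis
      by (simp add: weight_def min_absorb1)
  qed
  then show ?thesis
    by (simp add: total_weight_def)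
qed

lemma potential_le: "potential n G v \<le> total_weight n G v + 1"
  by (simp add: potential_def)

lemma exposed_degree: "u \<in> exposed n G v \<Longrightarrow> degree G u = 1"
  using degree_eq_1_iff[of G u] by (auto simp: exposed_def)

lemma exposed_join_no_leaf:
  assumes "\<forall>w\<in>light n G v. degree G w = 0"
  shows "exposed n (insert {v, u} G) v = {}"
proof (rule equals0I)
  fix w assume w: "w \<in> exposed n (insert {v, u} G) v"
  then have "w \<in> non_neighbours n G v - {u}"
    by (simp add: exposed_def flip: non_neighbours_join)
  moreover from this have "w \<noteq> v" "w \<noteq> u"
    by (simp_all add: non_neighbours_def)
  ultimately have "w \<in> light n G v" "degree G w = 1"
    using exposed_degree[OF w] by (auto simp: light_def degree_def neighbours_insert)
  then show False
    using assms by simp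
qed

lemma neighbours_insert_join:
  assumes "a \<noteq> b" "v \<notin> {a, b}"
  shows "neighbours (insert {v, a} (insert {a, b} G)) a = {v, b} \<union> neighbours G a"
    and "neighbours (insert {v, a} (insert {a, b} G)) b = insert a (neighbours G b)"
    and "u \<notin> {v, a, b} \<Longrightarrow> neighbours (insert {v, a} (insert {a, b} G)) u = neighbours G u"
  using assms by (auto simp: neighbours_insert)

lemma not_exposed_insert_join:
  assumes "G \<subseteq> all_edges n" "a \<noteq> b" "v \<notin> {a, b}" "{a, b} \<notin> G" "degree G a = degree G b"
  shows "b \<notin> exposed n (insert {v, a} (insert {a, b} G)) v"
proof
  assume "b \<in> exposed n (insert {v, a} (insert {a, b} G)) v"
  then obtain x where x: "insert a (neighbours G b) = {x}"
    "neighbours (insert {v, a} (insert {a, b} G)) x \<noteq> {v, b}"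
    using neighbours_insert_join(2)[OF assms(2,3)] by (auto simp: exposed_def)
  moreover have "a \<notin> neighbours G b"
    using assms(4) by (simp add: neighbours_def insert_commute)
  ultimately have "x = a" "neighbours G b = {}"
    by auto
  moreover from this have "neighbours G a = {}"
    using assms(5) finite_neighbours[OF assms(1)] by (simp add: degree_def)
  ultimately show False
    using x(2) neighbours_insert_join(1)[OF assms(2,3)] by simp
qed

lemma exposed_insert_join:
  assumes "G \<subseteq> all_edges n" "a \<noteq> b" "{a, b} \<notin> G" "degree G a = degree G b"
    and "a \<in> non_neighbours n G v" "b \<in> non_neighbours n G v"
  shows "exposed n (insert {v, a} (insert {a, b} G)) v \<subseteq> exposed n G v"
proof
  let ?H = "insert {v, a} (insert {a, b} G)"
  have v: "v \<notin> {a, b}"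
    using assms(5,6) by (auto simp: non_neighbours_def)
  note unchanged = neighbours_insert_join(3)[OF assms(2) v]
  fix w assume exposed: "w \<in> exposed n ?H v"
  then obtain x where w: "w \<in> non_neighbours n ?H v"
    and x: "neighbours ?H w = {x}" "neighbours ?H x \<noteq> {v, w}"
    by (auto simp: exposed_def)
  have "w \<noteq> b"
    using exposed not_exposed_insert_join[OF assms(1,2) v assms(3,4)] by blast
  moreover have "w \<noteq> v" "w \<noteq> a"
    using w by (simp_all add: non_neighbours_join) (simp add: non_neighbours_def)
  ultimately have Gw: "neighbours G w = {x}"
    using unchanged x(1) by simp
  have wG: "w \<in> non_neighbours n G v"
    using w non_neighbours_antimono[of G ?H n v] by auto
  have "neighbours G x \<noteq> {v, w}"
  proof
    assume Gx: "neighbours G x = {v, w}"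
    then have "x \<notin> non_neighbours n G v"
      using non_neighbours_sym[of x n G v] by auto
    moreover have "x \<noteq> v"
      using non_neighbours_sym[OF wG] Gw by auto
    ultimately have "neighbours ?H x = neighbours G x"
      using assms(5,6) by (intro unchanged) auto
    then show False
      using Gx x(2) by simp
  qed
  then show "w \<in> exposed n G v"
    using wG Gw by (auto simp: exposed_def)
qed

subsection \<open>Mini's strategy\<close>

definition Mini_ahead :: "nat \<Rightarrow> nat set set \<Rightarrow> nat \<Rightarrow> bool" where
  "Mini_ahead n G v \<longleftrightarrow> G \<subseteq> all_edges n \<and> colourable n G 3 \<and>
     (4 * card (non_neighbours n G v) \<le> n \<or> potential n G v < n)"

definition Mini_can_answer :: "nat \<Rightarrow> nat set set \<Rightarrow> nat \<Rightarrow> bool" where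
  "Mini_can_answer n G v \<longleftrightarrow> G \<subseteq> all_edges n \<and> colourable n G 3 \<and>
     (4 * card (non_neighbours n G v) \<le> n \<or>
      (\<exists>u\<in>non_neighbours n G v. Mini_ahead n (insert {v, u} G) v))"

lemma join_in_all_edges:
  assumes "v \<in> {1..n}" "u \<in> non_neighbours n G v"
  shows "{v, u} \<in> all_edges n - G"
  using assms by (auto simp: doubleton_in_all_edges_iff non_neighbours_def neighbours_def)

lemma colourable_join_light:
  assumes "v \<in> {1..n}" "G \<subseteq> all_edges n" "colourable n G 3" "u \<in> light n G v"
  shows "colourable n (insert {v, u} G) 3"
  using assms join_in_all_edges[of v n u G]
  by (intro colourable_insert_low_degree) (auto simp: light_def)

lemma Mini_can_answer_join:
  assumes "v \<in> {1..n}" "G \<subseteq> all_edges n" "colourable n G 3" "u \<in> non_neighbours n G v"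
    and "colourable n (insert {v, u} G) 3" "potential n (insert {v, u} G) v < n"
  shows "Mini_can_answer n G v"
  using assms join_in_all_edges[of v n u G] by (auto simp: Mini_can_answer_def Mini_ahead_def)

lemma Mini_can_answer_join_adjacent:
  assumes "v \<in> {1..n}" "G \<subseteq> all_edges n" "colourable n G 3" "a \<in> non_neighbours n G v"
    and "{a, b} \<in> G" "b \<noteq> v" "degree G a < 3" "degree G b < 3"
    and "potential n (insert {v, a} G) v < n"
  shows "Mini_can_answer n G v"
proof -
  have "insert {v, a} G \<subseteq> all_edges n"
    using assms(2) join_in_all_edges[OF assms(1,4)] by simp
  then have "colourable n (insert {v, a} G) 3"
    using assms(3,5-8) by (intro colourable_insert_adjacent_low_degrees)
  then show ?thesis
    using assms by (intro Mini_can_answer_join)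
qed

text \<open>Mini joins \<open>v\<close> to a light vertex, of degree \<open>1\<close> if possible: if there is none, then no vertex
  is exposed.\<close>

lemma Mini_can_answer_if_total_weight_le:
  assumes "v \<in> {1..n}" "G \<subseteq> all_edges n" "colourable n G 3" "total_weight n G v \<le> n"
  shows "Mini_can_answer n G v"
proof -
  have answer: ?thesis if "u \<in> light n G v" "potential n (insert {v, u} G) v < n" for u
    using that assms colourable_join_light[of v n G u]
    by (intro Mini_can_answer_join) (auto simp: light_def)
  have join: "total_weight n (insert {v, u} G) v + weight G u \<le> n" if "u \<in> light n G v" for u
    using that assms(4) total_weight_join[of u n G v] by (simp add: light_def)
  have "degree G w = 0 \<or> degree G w = 1" if "w \<in> light n G v" for w
    using that by (auto simp: light_def)
  then consider (leaf) u where "u \<in> light n G v" "degree G u = 1"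
    | (isolated) u where "u \<in> light n G v" "\<forall>w\<in>light n G v. degree G w = 0"
    | (none) "light n G v = {}"
    by blast
  then show ?thesis
  proof cases
    case (leaf u)
    then have "potential n (insert {v, u} G) v < n"
      using join[of u] potential_le[of n "insert {v, u} G" v] by (simp add: weight_def)
    then show ?thesis
      using answer leaf(1) by blast
  next
    case (isolated u)
    have "exposed n (insert {v, u} G) v = {}"
      using isolated(2) by (rule exposed_join_no_leaf)
    then have "potential n (insert {v, u} G) v < n"
      using join[of u] isolated by (simp add: potential_def weight_def)
    then show ?thesis
      using answer isolated(1) by blast
  next
    case none
    then show ?thesis
      using assms total_weight_no_light[of n G v] by (simp add: Mini_can_answer_def)
  qed
qed

lemma Mini_can_answer_insert_two_light:
  assumes "v \<in> {1..n}" "insert {a, b} G \<subseteq> all_edges n" "colourable n (insert {a, b} G) 3"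
    and "potential n G v < n" "{a, b} \<notin> G"
    and "a \<in> light n G v" "b \<in> light n G v" "degree G b \<le> degree G a"
  shows "Mini_can_answer n (insert {a, b} G) v"
proof (rule Mini_can_answer_join_adjacent[OF assms(1-3)])
  let ?G = "insert {a, b} G" and ?H = "insert {v, a} (insert {a, b} G)"
  have G: "G \<subseteq> all_edges n" and "a \<noteq> b"
    using assms(2) by (auto simp: doubleton_in_all_edges_iff)
  show "a \<in> non_neighbours n ?G v" "b \<noteq> v" "{a, b} \<in> ?G"
    using assms(6,7) by (auto simp: light_def non_neighbours_def neighbours_insert)
  have light_degree: "degree G a \<le> 1" "degree G b \<le> 1"
    using assms(6,7) by (simp_all add: light_def)
  then show "degree ?G a < 3" "degree ?G b < 3"
    by (simp_all add: degree_insert[OF G \<open>a \<noteq> b\<close> assms(5)])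
  have total: "total_weight n ?H v + weight G a = total_weight n G v + weight G b"
    using total_weight_insert_join[OF G \<open>a \<noteq> b\<close> assms(5) \<open>b \<noteq> v\<close> assms(6)] assms(7) by simp
  have "potential n ?H v \<le> potential n G v"
  proof (cases "degree G b = degree G a")
    case True
    then have "exposed n ?H v \<subseteq> exposed n G v"
      using G assms(5-7) \<open>a \<noteq> b\<close> by (intro exposed_insert_join) (auto simp: light_def)
    then show ?thesis
      using total True by (auto simp: potential_def weight_def)
  next
    case False
    then have "weight G b < weight G a"
      using assms(8) light_degree by (auto simp: weight_def min_def)
    then show ?thesis
      using total potential_le[of n ?H v] by (simp add: potential_def)
  qed
  then show "potential n ?H v < n"
    using assms(4) by simp
qed

lemma Mini_can_answer_insert_unexposed_leaf:
  assumes "v \<in> {1..n}" "insert {a, b} G \<subseteq> all_edges n" "colourable n (insert {a, b} G) 3"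
    and "potential n G v < n" "{a, b} \<notin> G" "b \<notin> light n G v" "b \<noteq> v"
    and "a \<in> non_neighbours n G v" "degree G a = 1" "a \<notin> exposed n G v"
  shows "Mini_can_answer n (insert {a, b} G) v"
proof -
  let ?G = "insert {a, b} G" and ?H = "insert {v, a} (insert {a, b} G)"
  have G: "G \<subseteq> all_edges n" and "a \<noteq> b"
    using assms(2) by (auto simp: doubleton_in_all_edges_iff)
  obtain x where x: "neighbours G a = {x}" "neighbours G x = {v, a}"
    using assms(8-10) degree_eq_1_iff[of G a] by (auto simp: exposed_def)
  have "x \<notin> {a, b}"
    using x(1) neighbours_subset[OF G, of a] assms(5) by (auto simp: neighbours_def)
  show ?thesis
  proof (rule Mini_can_answer_join_adjacent[OF assms(1-3)])
    have "v \<notin> {a, b}"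
      using assms(7,8) by (auto simp: non_neighbours_def)
    then show "a \<in> non_neighbours n ?G v"
      using assms(8) by (simp add: non_neighbours_insert)
    show "x \<noteq> v" "{a, x} \<in> ?G"
      using x(1) non_neighbours_sym[OF assms(8)] by (auto simp: neighbours_def)
    have "degree G x \<le> 2"
      using card_insert_le_m1[of 2 "{a}" v] by (simp add: degree_def x(2))
    then show "degree ?G a < 3" "degree ?G x < 3"
      using assms(9) \<open>x \<notin> {a, b}\<close> by (simp_all add: degree_insert[OF G \<open>a \<noteq> b\<close> assms(5)])
    have "a \<in> light n G v"
      using assms(8,9) by (simp add: light_def)
    then show "potential n ?H v < n"
      using total_weight_insert_join[OF G \<open>a \<noteq> b\<close> assms(5,7)] assms(4,6,9) potential_le[of n ?H v]
      by (simp add: potential_def weight_def)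
  qed
qed

lemma Mini_can_answer_insert_one_light:
  assumes "v \<in> {1..n}" "insert {a, b} G \<subseteq> all_edges n" "colourable n (insert {a, b} G) 3"
    and "potential n G v < n" "{a, b} \<notin> G"
    and "a \<in> light n G v" "b \<notin> light n G v" "b \<noteq> v"
  shows "Mini_can_answer n (insert {a, b} G) v"
proof (cases "total_weight n (insert {a, b} G) v \<le> n")
  case True
  then show ?thesis
    using assms(1-3) by (intro Mini_can_answer_if_total_weight_le)
next
  case False
  have G: "G \<subseteq> all_edges n" and "a \<noteq> b"
    using assms(2) by (auto simp: doubleton_in_all_edges_iff)
  have a: "a \<in> non_neighbours n G v" "degree G a \<le> 1"
    using assms(6) by (auto simp: light_def)
  have "v \<notin> {a, b}"
    using a(1) assms(8) by (auto simp: non_neighbours_def)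
  then have "total_weight n (insert {a, b} G) v = total_weight n G v + weight G a"
    using total_weight_insert[OF G \<open>a \<noteq> b\<close> assms(5)] assms(6,7) by simp
  then have "degree G a = 1" "exposed n G v = {}"
    using False assms(4) a(2)
    by (cases "exposed n G v = {}"; force simp: potential_def weight_def le_Suc_eq)+
  then show ?thesis
    using assms a(1) by (intro Mini_can_answer_insert_unexposed_leaf) auto
qed

lemma Mini_can_answer_insert_light:
  assumes "v \<in> {1..n}" "insert e G \<subseteq> all_edges n" "colourable n (insert e G) 3"
    and "potential n G v < n" "e \<notin> G" "v \<notin> e" "e \<inter> light n G v \<noteq> {}"
  shows "Mini_can_answer n (insert e G) v"
proof -
  have answer: ?thesis if "e = {x, y}" "x \<in> light n G v"
    "y \<in> light n G v \<Longrightarrow> degree G y \<le> degree G x" for x y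
    using Mini_can_answer_insert_two_light[of v n x y G] Mini_can_answer_insert_one_light[of v n x y G]
      assms(1-6) that by blast
  have "e \<in> all_edges n"
    using assms(2) by simp
  then obtain a b where "e = {a, b}"
    by (rule all_edgesE)
  moreover from this have "e = {b, a}"
    by (simp add: insert_commute)
  ultimately show ?thesis
    using answer[of a b] answer[of b a] assms(7) nat_le_linear[of "degree G a" "degree G b"]
    by blast
qed

lemma Mini_can_answer_insert:
  assumes "v \<in> {1..n}" "Mini_ahead n G v" "e \<in> legal_edges n (chi_gt 3 n) G"
  shows "Mini_can_answer n (insert e G) v"
proof -
  have G: "G \<subseteq> all_edges n"
    using assms(2) by (simp add: Mini_ahead_def)
  then have e: "e \<in> all_edges n - G" and eG: "insert e G \<subseteq> all_edges n"
    and col: "colourable n (insert e G) 3"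
    using assms(3) by (auto simp: legal_edges_chi_gt)
  consider (few) "4 * card (non_neighbours n G v) \<le> n"
    | (no_gain) "potential n G v < n" "v \<in> e \<or> e \<inter> light n G v = {}"
    | (light) "potential n G v < n" "v \<notin> e" "e \<inter> light n G v \<noteq> {}"
    using assms(2) by (auto simp: Mini_ahead_def)
  then show ?thesis
  proof cases
    case few
    then show ?thesis
      using eG col card_non_neighbours_antimono[OF subset_insertI[of G e], of n v]
      by (auto simp: Mini_can_answer_def)
  next
    case no_gain
    then have "total_weight n (insert e G) v \<le> n"
      using total_weight_insert_le[OF G e no_gain(2)] no_gain(1) by (simp add: potential_def)
    then show ?thesis
      using assms(1) eG col by (intro Mini_can_answer_if_total_weight_le)
  next
    case light
    then show ?thesis
      using assms(1) eG col e by (intro Mini_can_answer_insert_light) auto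
  qed
qed

lemma join_legal:
  assumes "v \<in> {1..n}" "G \<subseteq> all_edges n" "u \<in> non_neighbours n G v"
    and "colourable n (insert {v, u} G) 3"
  shows "{v, u} \<in> legal_edges n (chi_gt 3 n) G"
  using assms join_in_all_edges by (auto simp: legal_edges_chi_gt)

lemma Mini_ahead_reply:
  assumes "v \<in> {1..n}" "Mini_can_answer n G v" "legal_edges n (chi_gt 3 n) G \<noteq> {}"
  shows "\<exists>e\<in>legal_edges n (chi_gt 3 n) G. Mini_ahead n (insert e G) v"
proof (cases "4 * card (non_neighbours n G v) \<le> n")
  case True
  obtain e where e: "e \<in> legal_edges n (chi_gt 3 n) G"
    using assms(3) by blast
  have "Mini_ahead n (insert e G) v"
    using True e assms(2) card_non_neighbours_antimono[OF subset_insertI[of G e], of n v]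
    by (auto simp: Mini_ahead_def Mini_can_answer_def legal_edges_chi_gt)
  then show ?thesis
    using e by blast
next
  case False
  then obtain u where "u \<in> non_neighbours n G v" "Mini_ahead n (insert {v, u} G) v"
    using assms(2) by (auto simp: Mini_can_answer_def)
  then show ?thesis
    using join_legal[of v n G u] assms(1,2) by (auto simp: Mini_can_answer_def Mini_ahead_def)
qed

lemma few_non_neighbours_if_no_legal_edges:
  assumes "v \<in> {1..n}" "Mini_ahead n G v \<or> Mini_can_answer n G v"
    and "legal_edges n (chi_gt 3 n) G = {}"
  shows "4 * card (non_neighbours n G v) \<le> n"
proof -
  have G: "G \<subseteq> all_edges n" "colourable n G 3"
    using assms(2) by (auto simp: Mini_ahead_def Mini_can_answer_def)
  have stuck: "\<not> colourable n (insert {v, u} G) 3" if "u \<in> non_neighbours n G v" for u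
    using join_legal[OF assms(1) G(1) that] assms(3) by blast
  then have "light n G v = {}"
    using colourable_join_light[OF assms(1) G] by (auto simp: light_def)
  then have "total_weight n G v = 4 * card (non_neighbours n G v)"
    by (rule total_weight_no_light)
  then show ?thesis
    using assms(2) stuck by (auto simp: Mini_ahead_def Mini_can_answer_def potential_def)
qed

subsection \<open>The bound on the score\<close>

lemma card_colour_class_le_non_neighbours:
  assumes "proper_colouring n G k f"
  shows "card (colour_class n f (f v)) \<le> card (non_neighbours n G v) + 1"
proof -
  have "colour_class n f (f v) \<subseteq> insert v (non_neighbours n G v)"
    using proper_colouring_neighbours[OF assms, of _ v]
    by (fastforce simp: colour_class_def non_neighbours_def)
  then have "card (colour_class n f (f v)) \<le> card (insert v (non_neighbours n G v))"
    by (intro card_mono) (auto simp: finite_non_neighbours)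
  also have "\<dots> \<le> card (non_neighbours n G v) + 1"
    by (rule card_insert_le_m1) auto
  finally show ?thesis .
qed

lemma card_edges_le_if_few_non_neighbours:
  assumes "v \<in> {1..n}" "G \<subseteq> all_edges n" "colourable n G 3"
    and "4 * card (non_neighbours n G v) \<le> n"
  shows "real (card G) \<le> 21 / 64 * (real n)\<^sup>2 + 1 / 8 * real n"
proof -
  obtain f where f: "proper_colouring n G (Suc 2) f"
    using assms(3) by (auto simp: colourable_def eval_nat_numeral)
  define x where "x = real (card (colour_class n f (f v)))"
  have "f v < Suc 2"
    using f assms(1) by (rule proper_colouring_less)
  then have "4 * real (card G) + 2 * x\<^sup>2 + (real n - x)\<^sup>2 \<le> 2 * (real n)\<^sup>2"
    using card_edges_colour_class[OF assms(2) f] by (simp add: x_def)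
  then have "4 * real (card G) \<le> (real n)\<^sup>2 + 2 * real n * x - 3 * x\<^sup>2"
    by (simp add: power2_eq_square algebra_simps)
  also have "\<dots> = 19 / 16 * (real n)\<^sup>2 + 1 / 8 * real n * (4 * x) - 3 * (x - real n / 4)\<^sup>2"
    by (simp add: power2_eq_square algebra_simps)
  also have "\<dots> \<le> 19 / 16 * (real n)\<^sup>2 + 1 / 8 * real n * (real n + 4)"
  proof -
    have "4 * x \<le> real n + 4"
      using card_colour_class_le_non_neighbours[OF f, of v] assms(4) by (simp add: x_def)
    then have "1 / 8 * real n * (4 * x) \<le> 1 / 8 * real n * (real n + 4)"
      by (intro mult_left_mono) auto
    then show ?thesis
      using zero_le_power2[of "x - real n / 4"] by linarith
  qed
  also have "\<dots> = 21 / 16 * (real n)\<^sup>2 + 1 / 2 * real n"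
    by (simp add: power2_eq_square field_simps)
  finally show ?thesis
    by simp
qed

lemma score_chi_gt_3_le:
  assumes "n > 0"
  shows "real (score n (chi_gt 3 n) p) \<le> 21 / 64 * (real n)\<^sup>2 + 1 / 8 * real n"
proof -
  obtain v where v: "v \<in> {1..n}"
    using assms that[of n] by auto
  define Inv where
    "Inv p G = (case p of Mini \<Rightarrow> Mini_can_answer n G v | Maxi \<Rightarrow> Mini_ahead n G v)" for p G
  have "potential n {} v < n"
    using v by (simp add: potential_def exposed_def total_weight_empty)
  then have "Mini_ahead n {} v"
    by (simp add: Mini_ahead_def colourable_empty)
  moreover have "Mini_can_answer n {} v"
    using v
    by (intro Mini_can_answer_if_total_weight_le) (auto simp: colourable_empty total_weight_empty)
  ultimately have "Inv p {}"
    by (simp add: Inv_def split: player.split)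
  then have "real (game_value n (chi_gt 3 n) p {}) \<le> 21 / 64 * (real n)\<^sup>2 + 1 / 8 * real n"
  proof (rule game_value_le)
    fix p G assume final: "Inv p G" "legal_edges n (chi_gt 3 n) G = {}"
    then have "G \<subseteq> all_edges n" "colourable n G 3" "Mini_ahead n G v \<or> Mini_can_answer n G v"
      by (auto simp: Inv_def Mini_ahead_def Mini_can_answer_def split: player.splits)
    then show "real (card G) \<le> 21 / 64 * (real n)\<^sup>2 + 1 / 8 * real n"
      using card_edges_le_if_few_non_neighbours few_non_neighbours_if_no_legal_edges v final(2)
      by blast
  qed (auto simp: Inv_def intro: Mini_can_answer_insert[OF v] Mini_ahead_reply[OF v])
  then show ?thesis
    by (simp add: score_def)
qed

theorem theorem1p4:
  shows "\<exists>C::real. \<forall>n::nat.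
    real (score n (chi_gt 3 n) Mini) \<le> 21 / 64 * (real n)\<^sup>2 + C * real n \<and>
    real (score n (chi_gt 3 n) Maxi) \<le> 21 / 64 * (real n)\<^sup>2 + C * real n"
proof (intro exI[of _ "1 / 8"] allI conjI)
  fix n
  have "legal_edges 0 P {} = {}" for P
    by (auto simp: legal_edges_def all_edges_def)
  then have score_0: "score 0 P p = 0" for P p
    by (simp add: score_def game_value_final)
  have bound: "real (score n (chi_gt 3 n) p) \<le> 21 / 64 * (real n)\<^sup>2 + 1 / 8 * real n" for p
    using score_chi_gt_3_le[of n p] by (cases "n = 0") (simp_all add: score_0)
  show "real (score n (chi_gt 3 n) Mini) \<le> 21 / 64 * (real n)\<^sup>2 + 1 / 8 * real n"
    "real (score n (chi_gt 3 n) Maxi) \<le> 21 / 64 * (real n)\<^sup>2 + 1 / 8 * real n"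
    by (rule bound)+
qed

end
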